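(* Both the semidefinite program (P) and its dual (D) defined in the context admit optimal solutions (both optimal values are attained), and there is no duality gap (the two optimal values are equal).
   Context: Let $n\ge 1$, let $\hat Q\in\mathbb{R}^{n\times n}$ be symmetric (not necessarily positive semidefinite), $\hat l\in\mathbb{R}^n$, $\hat c\in\mathbb{R}$. For $i=1,\dots,n$ let $l_i,u_i\in\mathbb{Z}$ with $l_i<u_i$, $D_i=\{l_i,l_i+1,\dots,u_i\}$, $n_i=u_i-l_i+1$, and $m=\sum_{i=1}^n n_i$. Let $\beta=(\beta_{ij})_{1\le i\le n,\ l_i\le j\le u_i}\in\mathbb{R}^m$ be arbitrary. $S_{n+1}$ denotes the real symmetric $(n+1)\times(n+1)$ matrices, with rows and columns indexed by $0,1,\dots,n$, and $\langle\cdot,\cdot\rangle$ is the trace (Frobenius) inner product on matrices and the standard inner product on vectors. Put $Q=\begin{pmatrix}\hat c & \frac12\hat l^\top\\ \frac12\hat l & \hat Q\end{pmatrix}\in S_{n+1}$ and $A_0=e_0e_0^\top$, where $e_0=(1,0,\dots,0)^\top\in\mathbb{R}^{n+1}$. For $1\le i\le n$ and $l_i\le j\le u_i$ let $A_{ij}\in S_{n+1}$ be the matrix whose only possibly nonzero entries are: for $j=u_i$: $(A_{iu_i})_{00}=\beta_{iu_i}+l_iu_i$, $(A_{iu_i})_{0i}=(A_{iu_i})_{i0}=-\frac12(l_i+u_i)$, $(A_{iu_i})_{ii}=1$; for $l_i\le j\le u_i-1$: $(A_{ij})_{00}=\beta_{ij}-j(j+1)$, $(A_{ij})_{0i}=(A_{ij})_{i0}=j+\frac12$,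 $(A_{ij})_{ii}=-1$. The primal problem (P) is: minimize $\langle Q,X\rangle$ over $X\in S_{n+1}$ subject to $\langle A_0,X\rangle=1$, $\langle A_{ij},X\rangle\le\beta_{ij}$ for all $i=1,\dots,n$ and $j=l_i,\dots,u_i$, and $X\succeq0$. Vectors $y\in\mathbb{R}^{m+1}$ have coordinates $y_0$ and $y_{ij}$ ($1\le i\le n$, $l_i\le j\le u_i$). Put $\mathcal{A}^\top y=y_0A_0+\sum_{i,j}y_{ij}A_{ij}$, and let $b\in\mathbb{R}^{m+1}$ be given by $b_0=1$, $b_{ij}=\beta_{ij}$. The dual problem (D) is: maximize $\langle b,y\rangle$ subject to $Q-\mathcal{A}^\top y\succeq0$, $y_0\in\mathbb{R}$, $y_{ij}\le0$ for all $i,j$. *)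

theory Defs
  imports "HOL-Analysis.Analysis"
begin

text \<open>
  The type \<open>'n\<close> indexes the coordinates \<open>1, \<dots>, n\<close>, and \<open>'n option\<close> the rows and columns
  \<open>0, 1, \<dots>, n\<close>, with \<open>None\<close> in the role of \<open>0\<close>. The Frobenius inner product is the library
  inner product on \<open>real^'k^'k\<close>, by the following lemma.
\<close>

lemma inner_eq_trace:
  fixes A B :: "real^'k^'k"
  shows "A \<bullet> B = trace (transpose A ** B)"
proof -
  have "A \<bullet> B = (\<Sum>i\<in>UNIV. \<Sum>j\<in>UNIV. A $ i $ j * B $ i $ j)"
    by (simp add: inner_vec_def)
  also have "\<dots> = (\<Sum>j\<in>UNIV. \<Sum>i\<in>UNIV. A $ i $ j * B $ i $ j)"
    by (rule sum.swap)
  finally show ?thesis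
    by (simp add: trace_def matrix_matrix_mult_def transpose_def)
qed

definition symmetric_mat :: "real^'k^'k \<Rightarrow> bool" where
  "symmetric_mat A \<longleftrightarrow> transpose A = A"

definition psd :: "real^'k^'k \<Rightarrow> bool" where
  "psd A \<longleftrightarrow> symmetric_mat A \<and> (\<forall>x. 0 \<le> x \<bullet> (A *v x))"

definition Qmat :: "real^'n^'n \<Rightarrow> real^'n \<Rightarrow> real \<Rightarrow> real^'n option^'n option" where
  "Qmat Qhat lhat chat = (\<chi> r s. case (r, s) of
      (None, None) \<Rightarrow> chat
    | (None, Some k) \<Rightarrow> lhat $ k / 2
    | (Some k, None) \<Rightarrow> lhat $ k / 2
    | (Some k, Some k') \<Rightarrow> Qhat $ k $ k')"

definition e0 :: "real^('n::finite) option" where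
  "e0 = axis None 1"

definition A0 :: "real^('n::finite) option^'n option" where
  "A0 = (\<chi> r s. e0 $ r * e0 $ s)"

text \<open>The pairs \<open>(i, j)\<close> with \<open>l\<^sub>i \<le> j \<le> u\<^sub>i\<close>; there are \<open>m\<close> of them.\<close>

definition idx :: "('n \<Rightarrow> int) \<Rightarrow> ('n \<Rightarrow> int) \<Rightarrow> ('n \<times> int) set" where
  "idx l u = (SIGMA i:UNIV. {l i..u i})"

definition Amat :: "('n::finite \<Rightarrow> int) \<Rightarrow> ('n \<Rightarrow> int) \<Rightarrow> ('n \<times> int \<Rightarrow> real) \<Rightarrow> 'n \<times> int
    \<Rightarrow> real^'n option^'n option" where
  "Amat l u \<beta> = (\<lambda>(i, j). \<chi> r s. case (r, s) of
      (None, None) \<Rightarrow>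
        if j = u i then \<beta> (i, j) + of_int (l i * u i) else \<beta> (i, j) - of_int (j * (j + 1))
    | (None, Some k) \<Rightarrow>
        if k = i then (if j = u i then - of_int (l i + u i) / 2 else of_int j + 1 / 2) else 0
    | (Some k, None) \<Rightarrow>
        if k = i then (if j = u i then - of_int (l i + u i) / 2 else of_int j + 1 / 2) else 0
    | (Some k, Some k') \<Rightarrow>
        if k = i \<and> k' = i then (if j = u i then 1 else - 1) else 0)"

definition primal_feasible :: "('n::finite \<Rightarrow> int) \<Rightarrow> ('n \<Rightarrow> int) \<Rightarrow> ('n \<times> int \<Rightarrow> real)
    \<Rightarrow> real^'n option^'n option \<Rightarrow> bool" where
  "primal_feasible l u \<beta> X \<longleftrightarrow>
     symmetric_mat X \<and> A0 \<bullet> X = 1 \<and> (\<forall>p\<in>idx l u. Amat l u \<beta> p \<bullet> X \<le> \<beta> p) \<and> psd X"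

text \<open>
  A vector of \<open>\<real>\<^bsup>m+1\<^esup>\<close> is a pair of its coordinate \<open>y\<^sub>0\<close> and the family of its coordinates
  \<open>y\<^sub>i\<^sub>j\<close>; extensionality makes the latter a function on \<open>idx l u\<close> only.
\<close>

type_synonym 'n dvec = "real \<times> ('n \<times> int \<Rightarrow> real)"

definition dvecs :: "('n \<Rightarrow> int) \<Rightarrow> ('n \<Rightarrow> int) \<Rightarrow> 'n dvec set" where
  "dvecs l u = UNIV \<times> extensional (idx l u)"

definition dinner :: "('n \<Rightarrow> int) \<Rightarrow> ('n \<Rightarrow> int) \<Rightarrow> 'n dvec \<Rightarrow> 'n dvec \<Rightarrow> real" where
  "dinner l u a y = fst a * fst y + (\<Sum>p\<in>idx l u. snd a p * snd y p)"

definition bvec :: "('n \<Rightarrow> int) \<Rightarrow> ('n \<Rightarrow> int) \<Rightarrow> ('n \<times> int \<Rightarrow> real) \<Rightarrow> 'n dvec" where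
  "bvec l u \<beta> = (1, restrict \<beta> (idx l u))"

definition Aadj :: "('n::finite \<Rightarrow> int) \<Rightarrow> ('n \<Rightarrow> int) \<Rightarrow> ('n \<times> int \<Rightarrow> real) \<Rightarrow> 'n dvec
    \<Rightarrow> real^'n option^'n option" where
  "Aadj l u \<beta> y = fst y *\<^sub>R A0 + (\<Sum>p\<in>idx l u. snd y p *\<^sub>R Amat l u \<beta> p)"

definition dual_feasible :: "real^'n option^'n option \<Rightarrow> ('n::finite \<Rightarrow> int) \<Rightarrow> ('n \<Rightarrow> int)
    \<Rightarrow> ('n \<times> int \<Rightarrow> real) \<Rightarrow> 'n dvec \<Rightarrow> bool" where
  "dual_feasible Q l u \<beta> y \<longleftrightarrow>
     y \<in> dvecs l u \<and> psd (Q - Aadj l u \<beta> y) \<and> (\<forall>p\<in>idx l u. snd y p \<le> 0)"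

text \<open>
  Optimal values are extended reals, so that an infeasible or unbounded problem would have an
  infinite value.
\<close>

definition primal_value :: "real^'n option^'n option \<Rightarrow> ('n::finite \<Rightarrow> int) \<Rightarrow> ('n \<Rightarrow> int)
    \<Rightarrow> ('n \<times> int \<Rightarrow> real) \<Rightarrow> ereal" where
  "primal_value Q l u \<beta> = (INF X\<in>{X. primal_feasible l u \<beta> X}. ereal (Q \<bullet> X))"

definition dual_value :: "real^'n option^'n option \<Rightarrow> ('n::finite \<Rightarrow> int) \<Rightarrow> ('n \<Rightarrow> int)
    \<Rightarrow> ('n \<times> int \<Rightarrow> real) \<Rightarrow> ereal" where
  "dual_value Q l u \<beta> = (SUP y\<in>{y. dual_feasible Q l u \<beta> y}. ereal (dinner l u (bvec l u \<beta>) y))"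

end

theory Submission
  imports Defs
begin

text \<open>
  Subtracting \<open>\<beta>\<^sub>p\<close> times the equation \<open>\<langle>A\<^sub>0, X\<rangle> = 1\<close> from the inequality with index \<open>p\<close>
  gives a homogeneous inequality \<open>\<langle>H\<^sub>p, X\<rangle> \<le> 0\<close> in which \<open>\<beta>\<close> has disappeared. In terms of
  \<open>x\<^sub>i = X\<^sub>0\<^sub>i\<close> and with \<open>X\<^sub>0\<^sub>0 = 1\<close> the constraints say that \<open>X\<^sub>i\<^sub>i\<close> lies on or below the chord of the
  parabola \<open>x\<^sub>i\<^sup>2\<close> over \<open>[l\<^sub>i, u\<^sub>i]\<close>, and on or above the lines through its consecutive
  integer points. Everything rests on two properties of the closed cone \<open>F\<close> of the
  positive semidefinite \<open>X\<close> with \<open>\<langle>H\<^sub>p, X\<rangle> \<le> 0\<close> for all \<open>p\<close>.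

  The functional \<open>X\<^sub>0\<^sub>0\<close> is positive on \<open>F\<close> except at the origin (\<open>hom_cone_pos\<close>): when
  \<open>X\<^sub>0\<^sub>0 = 0\<close>, semidefiniteness kills the row \<open>0\<close>, and then the chord constraints kill the rest of the
  diagonal. Hence the feasible set of the primal problem, the slice \<open>X\<^sub>0\<^sub>0 = 1\<close> of \<open>F\<close>, is compact, and
  the primal problem attains its value, \<open>v\<close> say.

  \<open>F\<close> contains a positive definite matrix \<open>Z\<close> (\<open>interior_point\<close>): put \<open>x\<^sub>i\<close> at the midpoint of
  \<open>[l\<^sub>i, u\<^sub>i]\<close> and \<open>Z\<^sub>i\<^sub>i\<close> on the chord. If \<open>u\<^sub>i = l\<^sub>i + 1\<close>, the constraints force the equality
  of \<open>X\<^sub>i\<^sub>i\<close> with the chord, so no point satisfies all inequalities strictly; but the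
  inequalities are linear, and their validity at a definite \<open>Z\<close> is enough. It makes the cone
  \<open>K\<close> of all sums of a positive semidefinite matrix and a nonnegative combination of the \<open>-H\<^sub>p\<close>
  closed: the functional \<open>\<langle>Z, \<cdot>\<rangle>\<close> is nonnegative on both summands and bounds the semidefinite one in
  norm (\<open>closed_cone_sum\<close>).

  A dual feasible \<open>y\<close> of value \<open>v\<close> is precisely a representation of \<open>Q - v A\<^sub>0\<close> as an element of \<open>K\<close>.
  If there were none, a matrix \<open>W\<close> would separate \<open>Q - v A\<^sub>0\<close> from \<open>K\<close>. Such a \<open>W\<close> may be taken symmetric
  and then is a nonzero element of \<open>F\<close>; scaled to \<open>W\<^sub>0\<^sub>0 = 1\<close> it is primal feasible with
  \<open>\<langle>Q, W\<rangle> < v\<close>, which contradicts the choice of \<open>v\<close> (\<open>dual_attains_lower_bound\<close>). Weak duality,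
  which is the self-duality of the semidefinite cone (\<open>psd_inner_nonneg\<close>), then shows that \<open>v\<close>
  is the dual value.
\<close>

section \<open>Closed cones\<close>

text \<open>
  The intersection of the cone with the unit sphere is compact, so the functional has a positive
  minimum there; homogeneity does the rest.
\<close>

lemma cone_functional_bound:
  fixes C :: "'a::euclidean_space set" and w :: 'a
  assumes "closed C" and "conic C"
    and pos: "\<And>x. x \<in> C \<Longrightarrow> x \<noteq> 0 \<Longrightarrow> 0 < w \<bullet> x"
  obtains \<delta> where "0 < \<delta>" and "\<And>x. x \<in> C \<Longrightarrow> \<delta> * norm x \<le> w \<bullet> x"
proof -
  let ?S = "C \<inter> sphere 0 1"
  have "\<exists>\<delta>>0. \<forall>x\<in>?S. \<delta> \<le> w \<bullet> x"
  proof (cases "?S = {}")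
    case True
    then show ?thesis
      using zero_less_one by blast
  next
    case False
    have "compact ?S"
      using \<open>closed C\<close> by (simp add: closed_Int_compact)
    moreover have "continuous_on ?S (\<lambda>x. w \<bullet> x)"
      by (intro continuous_intros)
    ultimately obtain a where "a \<in> ?S" "\<forall>x\<in>?S. w \<bullet> a \<le> w \<bullet> x"
      using False continuous_attains_inf by blast
    moreover have "0 < w \<bullet> a"
      using \<open>a \<in> ?S\<close> by (intro pos) auto
    ultimately show ?thesis
      by blast
  qed
  then obtain \<delta> where \<delta>: "0 < \<delta>" "\<And>x. x \<in> ?S \<Longrightarrow> \<delta> \<le> w \<bullet> x"
    by blast
  have "\<delta> * norm x \<le> w \<bullet> x" if "x \<in> C" for x
  proof (cases "x = 0")
    case False
    then have "(1 / norm x) *\<^sub>R x \<in> ?S"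
      using conic_mul[OF assms(2) that] by simp
    from \<delta>(2)[OF this] show ?thesis
      using False by (simp add: field_simps)
  qed simp
  with \<delta>(1) that show thesis
    by blast
qed

text \<open>
  The sum of two closed cones need not be closed, because large summands can cancel. The
  functional \<open>w\<close> prevents this: near a limit point \<open>z\<close> of the sum, its value on the \<open>C\<close>-summand is at
  most \<open>w \<bullet> z + 1\<close>, so that summand stays in a compact part of \<open>C\<close>, and the sum of a compact and a
  closed set is closed.
\<close>

lemma closed_cone_sum:
  fixes C P :: "'a::euclidean_space set" and w :: 'a
  assumes "closed C" and "conic C"
    and "\<And>x. x \<in> C \<Longrightarrow> x \<noteq> 0 \<Longrightarrow> 0 < w \<bullet> x"
    and "closed P" and "\<And>x. x \<in> P \<Longrightarrow> 0 \<le> w \<bullet> x"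
  shows "closed (\<Union>x\<in>C. \<Union>y\<in>P. {x + y})"
proof -
  let ?K = "\<Union>x\<in>C. \<Union>y\<in>P. {x + y}"
  obtain \<delta> where \<delta>: "0 < \<delta>" "\<And>x. x \<in> C \<Longrightarrow> \<delta> * norm x \<le> w \<bullet> x"
    using cone_functional_bound[OF assms(1-3)] by blast
  have "z \<in> ?K" if z: "z \<in> closure ?K" for z
  proof -
    define r where "r = (w \<bullet> z + 1) / \<delta>"
    let ?L = "\<Union>x\<in>C \<inter> cball 0 r. \<Union>y\<in>P. {x + y}"
    have "closed ?L"
      using assms(1,4) by (intro compact_closed_sums closed_Int_compact) auto
    have sub: "?K \<inter> {v. w \<bullet> v < w \<bullet> z + 1} \<subseteq> ?L"
    proof clarsimp
      fix x y assume xy: "x \<in> C" "y \<in> P" "w \<bullet> (x + y) < w \<bullet> z + 1"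
      have "\<delta> * norm x \<le> w \<bullet> z + 1"
        using \<delta>(2)[OF xy(1)] assms(5)[OF xy(2)] xy(3) by (simp add: inner_add_right)
      then have "norm x \<le> r"
        using \<delta>(1) by (simp add: r_def field_simps)
      then show "\<exists>a\<in>C \<inter> cball 0 r. \<exists>b\<in>P. x + y = a + b"
        using xy by auto
    qed
    have "open {v. w \<bullet> v < w \<bullet> z + 1}"
      by (rule open_halfspace_lt)
    then have "z \<in> closure (?K \<inter> {v. w \<bullet> v < w \<bullet> z + 1})"
      using z open_Int_closure_subset[of "{v. w \<bullet> v < w \<bullet> z + 1}" ?K]
      by (auto simp: Int_commute)
    then have "z \<in> ?L"
      using closure_minimal[OF sub \<open>closed ?L\<close>] by blast
    then show ?thesis
      by blast
  qed
  then show ?thesis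
    by (simp add: closure_subset_eq[symmetric] subsetI)
qed

text \<open>
  For a cone the separating hyperplane can be moved to the origin: a functional that is
  bounded below on a cone is nonnegative on it.
\<close>

lemma convex_cone_separation:
  fixes K :: "'a::euclidean_space set"
  assumes "convex_cone K" and "closed K" and "z \<notin> K"
  obtains w where "w \<bullet> z < 0" and "\<And>x. x \<in> K \<Longrightarrow> 0 \<le> w \<bullet> x"
proof -
  have "convex K"
    using assms(1) by (simp add: convex_cone_def)
  then obtain a b where ab: "a \<bullet> z < b" "\<And>x. x \<in> K \<Longrightarrow> b < a \<bullet> x"
    using separating_hyperplane_closed_point assms by metis
  have "b < 0"
    using ab(2)[OF convex_cone_contains_0[OF assms(1)]] by simp
  have "0 \<le> a \<bullet> x" if x: "x \<in> K" for x
  proof (rule ccontr)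
    assume neg: "\<not> 0 \<le> a \<bullet> x"
    \<comment> \<open>the factor scales \<open>x\<close> onto the hyperplane \<open>a \<bullet> x = b\<close>, which \<open>K\<close> does not meet\<close>
    with \<open>b < 0\<close> have "(b / (a \<bullet> x)) *\<^sub>R x \<in> K"
      by (intro convex_cone_scaleR[OF assms(1)] x) (simp add: divide_nonpos_neg)
    from ab(2)[OF this] neg show False
      by simp
  qed
  with ab(1) \<open>b < 0\<close> that show thesis
    by (meson less_trans)
qed

lemma convex_cone_hull_image_sum:
  assumes "finite I" and "x \<in> convex_cone hull (g ` I)"
  obtains c where "\<And>i. i \<in> I \<Longrightarrow> 0 \<le> c i" and "x = (\<Sum>i\<in>I. c i *\<^sub>R g i)"
proof -
  have "\<exists>c. (\<forall>i\<in>I. 0 \<le> c i) \<and> x = (\<Sum>i\<in>I. c i *\<^sub>R g i)"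
    using assms(2)
  proof (rule hull_induct)
    fix y assume "y \<in> g ` I"
    then obtain k where k: "k \<in> I" "y = g k"
      by blast
    have "(\<Sum>i\<in>I. (if i = k then 1 else 0) *\<^sub>R g i) = (\<Sum>i\<in>I. if i = k then g i else 0)"
      by (rule sum.cong) auto
    also have "\<dots> = y"
      using k \<open>finite I\<close> by simp
    finally show "\<exists>c. (\<forall>i\<in>I. 0 \<le> c i) \<and> y = (\<Sum>i\<in>I. c i *\<^sub>R g i)"
      by (intro exI[of _ "\<lambda>i. if i = k then 1 else 0"]) simp
  next
    show "convex_cone {x. \<exists>c. (\<forall>i\<in>I. 0 \<le> c i) \<and> x = (\<Sum>i\<in>I. c i *\<^sub>R g i)}"
      unfolding convex_cone_iff
    proof (intro conjI ballI allI impI; clarsimp)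
      show "\<exists>c. (\<forall>i\<in>I. 0 \<le> c i) \<and> (\<Sum>i\<in>I. c i *\<^sub>R g i) = 0"
        by (intro exI[of _ "\<lambda>_. 0"]) simp
    next
      fix c d :: "_ \<Rightarrow> real" assume "\<forall>i\<in>I. 0 \<le> c i" "\<forall>i\<in>I. 0 \<le> d i"
      then show "\<exists>e. (\<forall>i\<in>I. 0 \<le> e i) \<and>
          (\<Sum>i\<in>I. c i *\<^sub>R g i) + (\<Sum>i\<in>I. d i *\<^sub>R g i) = (\<Sum>i\<in>I. e i *\<^sub>R g i)"
        by (intro exI[of _ "\<lambda>i. c i + d i"]) (simp add: scaleR_add_left sum.distrib)
    next
      fix c :: "_ \<Rightarrow> real" and t :: real assume "\<forall>i\<in>I. 0 \<le> c i" "0 \<le> t"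
      then show "\<exists>e. (\<forall>i\<in>I. 0 \<le> e i) \<and> t *\<^sub>R (\<Sum>i\<in>I. c i *\<^sub>R g i) = (\<Sum>i\<in>I. e i *\<^sub>R g i)"
        by (intro exI[of _ "\<lambda>i. t * c i"]) (simp add: scaleR_sum_right)
    qed
  qed
  with that show thesis
    by blast
qed


section \<open>Positive semidefinite matrices\<close>

lemma symmetric_mat_nth: "symmetric_mat A \<Longrightarrow> A $ i $ j = A $ j $ i"
  unfolding symmetric_mat_def transpose_def vec_eq_iff vec_lambda_beta by blast

lemma symmetric_matI: "(\<And>i j. A $ i $ j = A $ j $ i) \<Longrightarrow> symmetric_mat A"
  by (simp add: symmetric_mat_def transpose_def vec_eq_iff)

lemma psd_symmetric: "psd A \<Longrightarrow> symmetric_mat A"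
  by (simp add: psd_def)

lemma matrix_inner_sum:
  fixes A B :: "real^'k^'k"
  shows "A \<bullet> B = (\<Sum>i\<in>UNIV. \<Sum>j\<in>UNIV. A $ i $ j * B $ i $ j)"
  by (simp add: inner_vec_def)

lemma transpose_inner:
  fixes A B :: "real^'k^'k"
  shows "transpose A \<bullet> B = A \<bullet> transpose B"
  unfolding matrix_inner_sum transpose_def by (simp, rule sum.swap)

text \<open>
  Pairing with rank-one matrices turns the quadratic form of a matrix into a linear
  functional of the matrix, so that the semidefinite matrices become an intersection of
  half-spaces within the symmetric ones.
\<close>

definition outer :: "real^'k \<Rightarrow> real^'k^'k" where
  "outer v = (\<chi> i j. v $ i * v $ j)"

lemma inner_outer:
  fixes A :: "real^'k^'k"
  shows "A \<bullet> outer v = v \<bullet> (A *v v)"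
  by (simp add: matrix_inner_sum outer_def inner_vec_def matrix_vector_mult_def
      sum_distrib_left mult_ac)

lemma psd_iff_inner_outer: "psd A \<longleftrightarrow> symmetric_mat A \<and> (\<forall>v. 0 \<le> A \<bullet> outer v)"
  by (simp add: psd_def inner_outer)

lemma inner_outer_outer:
  fixes v w :: "real^'k"
  shows "outer v \<bullet> outer w = (v \<bullet> w)\<^sup>2"
  by (simp add: matrix_inner_sum outer_def inner_vec_def power2_eq_square sum_product mult_ac)

lemma psd_outer: "psd (outer v)"
  unfolding psd_iff_inner_outer
proof (intro conjI allI)
  show "symmetric_mat (outer v)"
    by (rule symmetric_matI) (simp add: outer_def mult.commute)
qed (simp add: inner_outer_outer)

lemma convex_cone_psd: "convex_cone {A. psd A}"
  unfolding convex_cone_iff psd_iff_inner_outer mem_Collect_eq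
  by (auto simp: inner_add_left symmetric_mat_def transpose_def vec_eq_iff)

lemma conic_psd: "conic {A. psd A}"
  using convex_cone_psd unfolding convex_cone_def by (elim conjE)

lemma psd_add: "psd A \<Longrightarrow> psd B \<Longrightarrow> psd (A + B)"
  using convex_cone_add[OF convex_cone_psd, of A B] by simp

lemma psd_scaleR: "psd A \<Longrightarrow> 0 \<le> c \<Longrightarrow> psd (c *\<^sub>R A)"
  using convex_cone_scaleR[OF convex_cone_psd, of c A] by simp

lemma psd_0: "psd 0"
  using convex_cone_contains_0[OF convex_cone_psd] by simp

lemma psd_sum: "(\<And>i. i \<in> I \<Longrightarrow> psd (f i)) \<Longrightarrow> psd (\<Sum>i\<in>I. f i)"
  by (induction I rule: infinite_finite_induct) (simp_all add: psd_0 psd_add)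

lemma closed_psd: "closed {A :: real^'k^'k. psd A}"
proof -
  have eq: "{A :: real^'k^'k. psd A} = {A. transpose A = A} \<inter> (\<Inter>v. {A. 0 \<le> A \<bullet> outer v})"
    by (auto simp: psd_iff_inner_outer symmetric_mat_def)
  have "closed {A :: real^'k^'k. transpose A = A}"
  proof -
    have "{A :: real^'k^'k. transpose A = A} = (\<Inter>i. \<Inter>j. {A. A $ i $ j = A $ j $ i})"
      by (auto simp: transpose_def vec_eq_iff)
    then show ?thesis
      by (auto intro!: closed_INT closed_Collect_eq continuous_intros)
  qed
  moreover have "closed {A. 0 \<le> A \<bullet> outer v}" for v :: "real^'k"
    by (intro closed_Collect_le continuous_intros)
  ultimately show ?thesis
    unfolding eq by (intro closed_Int closed_INT ballI)
qed

lemma symmetric_mat_mult_inner: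
  fixes A :: "real^'k^'k"
  assumes "symmetric_mat A"
  shows "x \<bullet> (A *v y) = y \<bullet> (A *v x)"
  using assms by (metis dot_lmul_matrix inner_commute symmetric_mat_def transpose_matrix_vector)

lemma axis_mult_axis:
  fixes A :: "real^'k^'k"
  shows "axis i 1 \<bullet> (A *v axis j 1) = A $ i $ j"
  by (simp add: matrix_vector_mult_basis inner_axis' column_def)

lemma outer_axis_inner: "outer (axis i 1) \<bullet> A = A $ i $ i"
  by (metis axis_mult_axis inner_commute inner_outer)

text \<open>
  The form is nonnegative on the plane spanned by \<open>x\<close> and \<open>y\<close>, so its discriminant there is not
  positive; the form may be degenerate.
\<close>

lemma psd_Cauchy_Schwarz:
  fixes A :: "real^'k^'k"
  assumes "psd A"
  shows "(x \<bullet> (A *v y))\<^sup>2 \<le> (x \<bullet> (A *v x)) * (y \<bullet> (A *v y))"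
proof -
  define a b c where "a = x \<bullet> (A *v x)" and "b = x \<bullet> (A *v y)" and "c = y \<bullet> (A *v y)"
  have nonneg: "0 \<le> v \<bullet> (A *v v)" for v
    using assms by (simp add: psd_def)
  have quad: "0 \<le> s\<^sup>2 * a + 2 * s * t * b + t\<^sup>2 * c" for s t
  proof -
    have "y \<bullet> (A *v x) = b"
      unfolding b_def using symmetric_mat_mult_inner[OF psd_symmetric[OF assms]] by blast
    then have "(s *\<^sub>R x + t *\<^sub>R y) \<bullet> (A *v (s *\<^sub>R x + t *\<^sub>R y))
        = s\<^sup>2 * a + 2 * s * t * b + t\<^sup>2 * c"
      by (simp add: a_def b_def c_def matrix_vector_right_distrib matrix_vector_mult_scaleR
          inner_add_left inner_add_right power2_eq_square algebra_simps)
    with nonneg show ?thesis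
      by metis
  qed
  have "b\<^sup>2 \<le> a * c"
  proof (cases "a = 0")
    case True
    have "b = 0"
    proof (rule ccontr)
      assume "b \<noteq> 0"
      \<comment> \<open>at this point of the line \<open>t = 1\<close> the form, affine when \<open>a = 0\<close>, takes the value \<open>-1\<close>\<close>
      with quad[of "- (c + 1) / (2 * b)" 1] True show False
        by (simp add: field_simps)
    qed
    with True show ?thesis
      by simp
  next
    case False
    with nonneg[of x] have "0 < a"
      by (simp add: a_def)
    have "0 \<le> a * (a * c - b\<^sup>2)"
      using quad[of "- b" a] by (simp add: power2_eq_square algebra_simps)
    with \<open>0 < a\<close> show ?thesis
      by (simp add: zero_le_mult_iff)
  qed
  then show ?thesis
    by (simp add: a_def b_def c_def)
qed

lemma psd_diag_nonneg: "psd A \<Longrightarrow> 0 \<le> A $ i $ i"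
  by (metis axis_mult_axis psd_def)

lemma psd_zero_diag:
  assumes "psd A" and "A $ i $ i = 0 \<or> A $ j $ j = 0"
  shows "A $ i $ j = 0"
  using psd_Cauchy_Schwarz[OF assms(1), of "axis i 1" "axis j 1"] assms(2)
  by (auto simp: axis_mult_axis)

lemma psd_zero_diag_eq_0:
  assumes "psd A" and "\<And>i. A $ i $ i = 0"
  shows "A = 0"
  using psd_zero_diag[OF assms(1) disjI1[OF assms(2)]] by (simp add: vec_eq_iff)

text \<open>
  The semidefinite cone is contained in its dual. The proof replaces the spectral decomposition
  of \<open>X\<close> by Cholesky elimination: if \<open>X\<^sub>i\<^sub>i > 0\<close> and \<open>v\<close> is column \<open>i\<close> of \<open>X\<close>, then \<open>X - v v\<^sup>T / X\<^sub>i\<^sub>i\<close> is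
  semidefinite by Cauchy-Schwarz and has fewer nonzero diagonal entries, and the
  rank-one term that was split off pairs nonnegatively with \<open>S\<close>.
\<close>

lemma psd_inner_nonneg:
  fixes S X :: "real^'k^'k"
  assumes "psd S" and "psd X"
  shows "0 \<le> S \<bullet> X"
  using assms(2)
proof (induction "card {i. X $ i $ i \<noteq> 0}" arbitrary: X rule: less_induct)
  case less
  show ?case
  proof (cases "\<exists>i. X $ i $ i \<noteq> 0")
    case False
    then have "X = 0"
      using psd_zero_diag_eq_0[OF less.prems] by blast
    then show ?thesis
      by simp
  next
    case True
    then obtain i where i: "X $ i $ i \<noteq> 0"
      by blast
    define a where "a = X $ i $ i"
    have "0 < a"
      using i psd_diag_nonneg[OF less.prems, of i] by (simp add: a_def)
    define v where "v = X *v axis i 1"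
    define Y where "Y = X - (1 / a) *\<^sub>R outer v"
    have v_nth: "v $ j = X $ j $ i" for j
      by (simp add: v_def matrix_vector_mult_basis column_def)
    have "psd Y"
      unfolding psd_iff_inner_outer
    proof (intro conjI allI)
      show "symmetric_mat Y"
        using symmetric_mat_nth[OF psd_symmetric[OF less.prems]]
        by (intro symmetric_matI) (simp add: Y_def outer_def mult.commute)
      fix w
      have "(w \<bullet> v)\<^sup>2 \<le> (w \<bullet> (X *v w)) * a"
        using psd_Cauchy_Schwarz[OF less.prems, of w "axis i 1"]
        by (simp add: v_def a_def axis_mult_axis)
      moreover have "Y \<bullet> outer w = w \<bullet> (X *v w) - (w \<bullet> v)\<^sup>2 / a"
        by (simp add: Y_def inner_diff_left inner_outer_outer inner_outer[of X] inner_commute[of v])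
      ultimately show "0 \<le> Y \<bullet> outer w"
        using \<open>0 < a\<close> by (simp only:) (simp add: field_simps)
    qed
    have "Y $ i $ i = 0"
      using \<open>0 < a\<close> by (simp add: Y_def outer_def v_nth a_def)
    moreover have "Y $ j $ j = 0" if "X $ j $ j = 0" for j
      using psd_zero_diag[OF less.prems, of j i] that by (simp add: Y_def outer_def v_nth)
    ultimately have "{j. Y $ j $ j \<noteq> 0} \<subset> {j. X $ j $ j \<noteq> 0}"
      using i by auto
    then have "0 \<le> S \<bullet> Y"
      using less.hyps[OF _ \<open>psd Y\<close>] by (simp add: psubset_card_mono)
    moreover have "0 \<le> S \<bullet> outer v"
      using assms(1) by (simp add: psd_iff_inner_outer)
    moreover have "X = Y + (1 / a) *\<^sub>R outer v"
      by (simp add: Y_def)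
    ultimately show ?thesis
      using \<open>0 < a\<close> by (simp add: inner_add_right)
  qed
qed


section \<open>The homogenised constraints\<close>

lemma sum_option_UNIV:
  fixes f :: "'n::finite option \<Rightarrow> real"
  shows "sum f UNIV = f None + (\<Sum>i\<in>UNIV. f (Some i))"
  by (simp add: UNIV_option_conv sum.reindex)

lemma A0_eq_outer: "A0 = outer (axis None 1)"
  by (simp add: A0_def outer_def e0_def)

lemma A0_inner: "A0 \<bullet> X = X $ None $ None"
  by (simp add: A0_eq_outer outer_axis_inner)

lemma finite_idx: "finite (idx l (u :: 'n::finite \<Rightarrow> int))"
  by (simp add: idx_def)

definition Hmat :: "('n::finite \<Rightarrow> int) \<Rightarrow> ('n \<Rightarrow> int) \<Rightarrow> ('n \<times> int \<Rightarrow> real) \<Rightarrow> 'n \<times> int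
    \<Rightarrow> real^'n option^'n option" where
  "Hmat l u \<beta> p = Amat l u \<beta> p - \<beta> p *\<^sub>R A0"

text \<open>
  For \<open>X\<^sub>0\<^sub>0 = 1\<close> the first case compares \<open>X\<^sub>i\<^sub>i\<close> with the chord of the parabola over \<open>[l\<^sub>i, u\<^sub>i]\<close>, and
  the second with the chord over \<open>[j, j + 1]\<close>.
\<close>

lemma Hmat_inner:
  assumes "symmetric_mat X"
  shows "Hmat l u \<beta> (i, j) \<bullet> X =
    (if j = u i
     then X $ Some i $ Some i - of_int (l i + u i) * X $ None $ Some i
       + of_int (l i * u i) * X $ None $ None
     else - X $ Some i $ Some i + of_int (2 * j + 1) * X $ None $ Some i
       - of_int (j * (j + 1)) * X $ None $ None)"
proof -
  \<comment> \<open>the matrix is supported on the indices \<open>0\<close> and \<open>i\<close>, so the sums over all coordinates collapse\<close>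
  have delta: "(\<Sum>k\<in>UNIV. (if k = i then c else 0) * f k) = c * f i" for c and f :: "'a \<Rightarrow> real"
  proof -
    have "(\<Sum>k\<in>UNIV. (if k = i then c else 0) * f k) = (\<Sum>k\<in>UNIV. if k = i then c * f k else 0)"
      by (rule sum.cong) auto
    then show ?thesis
      by simp
  qed
  have delta2: "(\<Sum>k\<in>UNIV. \<Sum>k'\<in>UNIV. (if k = i \<and> k' = i then c else 0) * f k k') = c * f i i"
    for c and f :: "'a \<Rightarrow> 'a \<Rightarrow> real"
  proof -
    have "(\<Sum>k\<in>UNIV. \<Sum>k'\<in>UNIV. (if k = i \<and> k' = i then c else 0) * f k k')
        = (\<Sum>k\<in>UNIV. if k = i then (\<Sum>k'\<in>UNIV. (if k' = i then c else 0) * f k k') else 0)"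
      by (rule sum.cong) auto
    then show ?thesis
      by (simp add: delta)
  qed
  have "Amat l u \<beta> (i, j) \<bullet> X =
      Amat l u \<beta> (i, j) $ None $ None * X $ None $ None
      + (if j = u i then - of_int (l i + u i) else of_int (2 * j + 1)) * X $ None $ Some i
      + (if j = u i then 1 else - 1) * X $ Some i $ Some i"
    unfolding matrix_inner_sum sum_option_UNIV sum.distrib
    by (simp add: Amat_def delta delta2 symmetric_mat_nth[OF assms, of "Some i" None])
  then show ?thesis
    by (simp add: Hmat_def inner_diff_left A0_inner Amat_def algebra_simps)
qed

lemma symmetric_Hmat: "symmetric_mat (Hmat l u \<beta> p)"
  by (rule symmetric_matI)
    (auto simp: Hmat_def Amat_def A0_def mult.commute split: prod.split option.split)

definition hom_cone :: "('n::finite \<Rightarrow> int) \<Rightarrow> ('n \<Rightarrow> int) \<Rightarrow> ('n \<times> int \<Rightarrow> real)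
    \<Rightarrow> (real^'n option^'n option) set" where
  "hom_cone l u \<beta> = {X. psd X \<and> (\<forall>p\<in>idx l u. Hmat l u \<beta> p \<bullet> X \<le> 0)}"

lemma conic_hom_cone: "conic (hom_cone l u \<beta>)"
  by (auto simp: conic_def hom_cone_def psd_scaleR mult_nonneg_nonpos)

lemma closed_hom_cone: "closed (hom_cone l u \<beta>)"
proof -
  have "hom_cone l u \<beta> = {X. psd X} \<inter> (\<Inter>p\<in>idx l u. {X. Hmat l u \<beta> p \<bullet> X \<le> 0})"
    by (auto simp: hom_cone_def)
  then show ?thesis
    by (auto intro: closed_psd closed_halfspace_le)
qed

lemma primal_feasible_iff: "primal_feasible l u \<beta> X \<longleftrightarrow> X \<in> hom_cone l u \<beta> \<and> A0 \<bullet> X = 1"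
  by (auto simp: primal_feasible_def hom_cone_def psd_symmetric Hmat_def inner_diff_left)

text \<open>
  This is boundedness of the feasible set in homogeneous form: the cone has no nonzero
  direction with \<open>X\<^sub>0\<^sub>0 = 0\<close>. The inequalities with \<open>j = u\<^sub>i\<close> provide it, since they bound \<open>X\<^sub>i\<^sub>i\<close> from
  above.
\<close>

lemma hom_cone_pos:
  assumes lu: "\<And>i. l i < u i" and X: "X \<in> hom_cone l u \<beta>" and "X \<noteq> 0"
  shows "0 < A0 \<bullet> X"
proof (rule ccontr)
  assume "\<not> 0 < A0 \<bullet> X"
  have psd: "psd X"
    using X by (simp add: hom_cone_def)
  then have X00: "X $ None $ None = 0"
    using \<open>\<not> 0 < A0 \<bullet> X\<close> psd_diag_nonneg[OF psd, of None] by (simp add: A0_inner)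
  have "X $ Some i $ Some i = 0" for i
  proof -
    have "(i, u i) \<in> idx l u"
      using lu[of i] by (simp add: idx_def)
    then have "Hmat l u \<beta> (i, u i) \<bullet> X \<le> 0"
      using X by (simp add: hom_cone_def)
    moreover have "X $ None $ Some i = 0"
      using psd_zero_diag[OF psd] X00 by blast
    ultimately have "X $ Some i $ Some i \<le> 0"
      by (simp add: Hmat_inner psd_symmetric[OF psd] X00)
    then show ?thesis
      using psd_diag_nonneg[OF psd, of "Some i"] by simp
  qed
  then have "X $ r $ r = 0" for r
    using X00 by (cases r) auto
  then have "X = 0"
    using psd_zero_diag_eq_0[OF psd] by blast
  with \<open>X \<noteq> 0\<close> show False
    by contradiction
qed

text \<open>
  The constraint qualification. The witness is \<open>x x\<^sup>T + D\<close>, where \<open>x = (1, (l + u) / 2)\<close> and \<open>D\<close> is the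
  diagonal matrix with \<open>D\<^sub>0\<^sub>0 = 0\<close> and \<open>D\<^sub>i\<^sub>i = ((u\<^sub>i - l\<^sub>i) / 2)\<^sup>2\<close>, the height of the chord above the
  parabola at the midpoint. Definiteness is stated as
  positivity on the nonzero semidefinite matrices, which is the form that \<open>closed_cone_sum\<close> takes.
\<close>

lemma interior_point:
  fixes l u :: "'n::finite \<Rightarrow> int"
  assumes lu: "\<And>i. l i < u i"
  obtains Z where "primal_feasible l u \<beta> Z" and "\<And>S. psd S \<Longrightarrow> S \<noteq> 0 \<Longrightarrow> 0 < Z \<bullet> S"
proof -
  define x :: "real^'n option" where
    "x = (\<chi> r. case r of None \<Rightarrow> 1 | Some i \<Rightarrow> of_int (l i + u i) / 2)"
  define d :: "'n \<Rightarrow> real" where "d i = (of_int (u i - l i) / 2)\<^sup>2" for i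
  define D where "D = (\<Sum>i\<in>UNIV. d i *\<^sub>R outer (axis (Some i) (1::real)))"
  define Z where "Z = outer x + D"
  have inner_D: "D \<bullet> S = (\<Sum>i\<in>UNIV. d i * S $ Some i $ Some i)" for S
    by (simp add: D_def inner_sum_left outer_axis_inner)
  have D_nth: "D $ r $ s = (\<Sum>i\<in>UNIV. d i * (axis (Some i) 1 $ r * axis (Some i) 1 $ s))" for r s
    by (simp add: D_def outer_def)
  have dpos: "0 < d i" for i
    using lu[of i] by (simp add: d_def)
  have Z00: "Z $ None $ None = 1"
    by (simp add: Z_def D_nth outer_def x_def axis_def)
  have Z0i: "Z $ None $ Some i = of_int (l i + u i) / 2" for i
    by (simp add: Z_def D_nth outer_def x_def axis_def)
  have Zii: "Z $ Some i $ Some i = (of_int (l i + u i) / 2)\<^sup>2 + d i" for i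
  proof -
    have "D $ Some i $ Some i = (\<Sum>k\<in>UNIV. if k = i then d k else 0)"
      unfolding D_nth by (rule sum.cong) (auto simp: axis_def)
    then show ?thesis
      by (simp add: Z_def outer_def x_def power2_eq_square)
  qed
  have "psd D"
    unfolding D_def by (intro psd_sum psd_scaleR psd_outer less_imp_le dpos)
  then have "psd Z"
    by (simp add: Z_def psd_add psd_outer)
  have "Hmat l u \<beta> p \<bullet> Z \<le> 0" for p
  proof -
    obtain i j where p: "p = (i, j)"
      by (cases p)
    define a b t :: real where "a = of_int (l i)" and "b = of_int (u i)" and "t = of_int j"
    have entries: "Z $ None $ None = 1" "Z $ None $ Some i = (a + b) / 2"
        "Z $ Some i $ Some i = ((a + b) / 2)\<^sup>2 + ((b - a) / 2)\<^sup>2"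
      by (simp_all add: Z00 Z0i Zii d_def a_def b_def)
    show ?thesis
    proof (cases "j = u i")
      case True
      then have "Hmat l u \<beta> p \<bullet> Z
          = ((a + b) / 2)\<^sup>2 + ((b - a) / 2)\<^sup>2 - (a + b) * ((a + b) / 2) + a * b"
        by (simp add: p Hmat_inner psd_symmetric[OF \<open>psd Z\<close>] entries)
          (simp add: a_def b_def)
      also have "\<dots> = 0"
        by (simp add: power2_eq_square field_simps)
      finally show ?thesis
        by simp
    next
      case False
      then have "Hmat l u \<beta> p \<bullet> Z
          = - (((a + b) / 2)\<^sup>2 + ((b - a) / 2)\<^sup>2) + (2 * t + 1) * ((a + b) / 2) - t * (t + 1)"
        by (simp add: p Hmat_inner psd_symmetric[OF \<open>psd Z\<close>] entries)
          (simp add: t_def)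
      \<comment> \<open>completing the square: a chord over \<open>[j, j + 1]\<close> is at most \<open>1/4\<close> above the parabola inside the
        interval and below it outside, and \<open>1/4\<close> is the least value of \<open>((u\<^sub>i - l\<^sub>i) / 2)\<^sup>2\<close> for integers
        \<open>l\<^sub>i < u\<^sub>i\<close>\<close>
      also have "\<dots> = 1 / 4 - ((a + b) / 2 - t - 1 / 2)\<^sup>2 - ((b - a) / 2)\<^sup>2"
        by (simp add: power2_eq_square field_simps)
      also have "\<dots> \<le> 1 / 4 - ((b - a) / 2)\<^sup>2"
        by simp
      also have "\<dots> \<le> 0"
      proof -
        have "1 \<le> b - a"
          using lu[of i] unfolding a_def b_def by linarith
        then have "(1 / 2)\<^sup>2 \<le> ((b - a) / 2)\<^sup>2"
          by (intro power_mono) auto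
        then show ?thesis
          by (simp add: power2_eq_square)
      qed
      finally show ?thesis .
    qed
  qed
  then have "primal_feasible l u \<beta> Z"
    using \<open>psd Z\<close> by (simp add: primal_feasible_iff hom_cone_def A0_inner Z00)
  moreover have "0 < Z \<bullet> S" if S: "psd S" "S \<noteq> 0" for S
  proof -
    have nn: "0 \<le> d i * S $ Some i $ Some i" for i
      using dpos[of i] psd_diag_nonneg[OF S(1), of "Some i"] by simp
    have nx: "0 \<le> S \<bullet> outer x"
      using S(1) by (simp add: psd_iff_inner_outer)
    have ZS: "Z \<bullet> S = S \<bullet> outer x + (\<Sum>i\<in>UNIV. d i * S $ Some i $ Some i)"
      by (simp add: Z_def inner_add_left inner_D inner_commute[of "outer x"])
    \<comment> \<open>if both summands vanish, \<open>D\<close> kills all of \<open>S\<close> but \<open>S\<^sub>0\<^sub>0\<close>, and \<open>x x\<^sup>T\<close> kills that, as \<open>x\<^sub>0 = 1\<close>\<close>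
    have "Z \<bullet> S \<noteq> 0"
    proof
      assume "Z \<bullet> S = 0"
      then have 0: "S \<bullet> outer x = 0" "(\<Sum>i\<in>UNIV. d i * S $ Some i $ Some i) = 0"
        using ZS nx sum_nonneg[of UNIV "\<lambda>i. d i * S $ Some i $ Some i"] nn by auto
      then have "d i * S $ Some i $ Some i = 0" for i
        using sum_nonneg_eq_0_iff[of UNIV "\<lambda>i. d i * S $ Some i $ Some i"] nn by simp
      then have Sii: "S $ Some i $ Some i = 0" for i
        using dpos[of i] by (metis less_irrefl mult_eq_0_iff)
      then have "S $ Some i $ r = 0" "S $ r $ Some i = 0" for i r
        using psd_zero_diag[OF S(1)] by blast+
      then have "S \<bullet> outer x = S $ None $ None"
        unfolding matrix_inner_sum sum_option_UNIV by (simp add: outer_def x_def)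
      with 0 Sii have "S $ r $ r = 0" for r
        by (cases r) auto
      then have "S = 0"
        using psd_zero_diag_eq_0[OF S(1)] by blast
      with S(2) show False
        by contradiction
    qed
    then show ?thesis
      using ZS nx sum_nonneg[of UNIV "\<lambda>i. d i * S $ Some i $ Some i"] nn by force
  qed
  ultimately show thesis
    using that by blast
qed


section \<open>Duality\<close>

lemma primal_attained:
  assumes lu: "\<And>i. l i < u i"
  obtains X where "primal_feasible l u \<beta> X"
    and "\<And>Y. primal_feasible l u \<beta> Y \<Longrightarrow> Q \<bullet> X \<le> Q \<bullet> Y"
proof -
  let ?F = "{X. primal_feasible l u \<beta> X}"
  have pos: "0 < A0 \<bullet> X" if "X \<in> hom_cone l u \<beta>" "X \<noteq> 0" for X
    using hom_cone_pos[where l = l and u = u and \<beta> = \<beta>, OF lu that] .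
  obtain \<delta> where \<delta>: "0 < \<delta>" "\<And>X. X \<in> hom_cone l u \<beta> \<Longrightarrow> \<delta> * norm X \<le> A0 \<bullet> X"
    using cone_functional_bound[OF closed_hom_cone conic_hom_cone pos] by blast
  have "?F = hom_cone l u \<beta> \<inter> {X. A0 \<bullet> X = 1}"
    by (auto simp: primal_feasible_iff)
  then have "closed ?F"
    by (simp add: closed_Int closed_hom_cone closed_hyperplane)
  moreover have "bounded ?F"
    unfolding bounded_iff
    using \<delta> by (intro exI[of _ "1 / \<delta>"]) (fastforce simp: primal_feasible_iff field_simps)
  ultimately have "compact ?F"
    by (simp add: compact_eq_bounded_closed)
  moreover have "?F \<noteq> {}"
    by (rule interior_point[where l = l and u = u and \<beta> = \<beta>, OF lu]) auto
  moreover have "continuous_on ?F (\<lambda>X. Q \<bullet> X)"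
    by (intro continuous_intros)
  ultimately have "\<exists>X\<in>?F. \<forall>Y\<in>?F. Q \<bullet> X \<le> Q \<bullet> Y"
    by (rule continuous_attains_inf)
  with that show thesis
    by blast
qed

lemma dinner_bvec: "dinner l u (bvec l u \<beta>) y = fst y + (\<Sum>p\<in>idx l u. \<beta> p * snd y p)"
  by (simp add: dinner_def bvec_def)

text \<open>
  In homogenised form the coefficient of \<open>A\<^sub>0\<close> is the dual objective, so that fixing the
  objective value leaves a pure cone membership question.
\<close>

lemma Aadj_eq_Hmat:
  "Aadj l u \<beta> y = dinner l u (bvec l u \<beta>) y *\<^sub>R A0 + (\<Sum>p\<in>idx l u. snd y p *\<^sub>R Hmat l u \<beta> p)"
  by (simp add: Aadj_def dinner_bvec Hmat_def scaleR_diff_right sum_subtractf scaleR_add_left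
      scaleR_sum_left mult.commute)

lemma weak_duality:
  assumes "primal_feasible l u \<beta> X" and "dual_feasible Q l u \<beta> y"
  shows "dinner l u (bvec l u \<beta>) y \<le> Q \<bullet> X"
proof -
  have X: "psd X" "A0 \<bullet> X = 1" "\<And>p. p \<in> idx l u \<Longrightarrow> Hmat l u \<beta> p \<bullet> X \<le> 0"
    using assms(1) by (auto simp: primal_feasible_iff hom_cone_def)
  have "0 \<le> (Q - Aadj l u \<beta> y) \<bullet> X"
    using assms(2) X(1) by (intro psd_inner_nonneg) (auto simp: dual_feasible_def)
  moreover have "0 \<le> (\<Sum>p\<in>idx l u. snd y p * (Hmat l u \<beta> p \<bullet> X))"
    using assms(2) X(3) by (intro sum_nonneg mult_nonpos_nonpos) (auto simp: dual_feasible_def)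
  ultimately show ?thesis
    by (simp add: inner_diff_left Aadj_eq_Hmat inner_add_left inner_sum_left X(2))
qed

text \<open>
  Every lower bound \<open>v\<close> of the primal objective is the objective value of some dual feasible point:
  \<open>Q - v A\<^sub>0\<close> lies in the bipolar of the cone \<open>K\<close> below, and \<open>K\<close> is closed.
\<close>

lemma dual_attains_lower_bound:
  assumes lu: "\<And>i. l i < u i" and Q: "symmetric_mat Q"
    and v: "\<And>X. primal_feasible l u \<beta> X \<Longrightarrow> v \<le> Q \<bullet> X"
  obtains y where "dual_feasible Q l u \<beta> y" and "dinner l u (bvec l u \<beta>) y = v"
proof -
  let ?g = "\<lambda>p. - Hmat l u \<beta> p"
  let ?P = "convex_cone hull (?g ` idx l u)"
  let ?K = "\<Union>S\<in>{S. psd S}. \<Union>T\<in>?P. {S + T}"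
  define M where "M = Q - v *\<^sub>R A0"
  obtain Z where Z: "primal_feasible l u \<beta> Z" "\<And>S. psd S \<Longrightarrow> S \<noteq> 0 \<Longrightarrow> 0 < Z \<bullet> S"
    using interior_point[where l = l and u = u and \<beta> = \<beta>, OF lu] by blast
  have "closed ?K"
  proof (rule closed_cone_sum[of _ Z])
    show "closed ?P"
      by (simp add: closed_convex_cone_hull finite_idx)
    have "?P \<subseteq> {T. 0 \<le> Z \<bullet> T}"
      using Z(1) by (intro hull_minimal convex_cone_halfspace_ge)
        (auto simp: primal_feasible_iff hom_cone_def inner_commute[of Z])
    then show "0 \<le> Z \<bullet> T" if "T \<in> ?P" for T
      using that by blast
  qed (auto simp: closed_psd conic_psd Z(2))
  have cone: "convex_cone ?K"
    by (intro convex_cone_sums convex_cone_psd convex_cone_convex_cone_hull)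
  have "M \<in> ?K"
  proof (rule ccontr)
    assume "M \<notin> ?K"
    then obtain w where w: "w \<bullet> M < 0" "\<And>N. N \<in> ?K \<Longrightarrow> 0 \<le> w \<bullet> N"
      using convex_cone_separation[OF cone \<open>closed ?K\<close>] by blast
    \<comment> \<open>separation takes place among all square matrices; as \<open>M\<close> and \<open>K\<close> consist of symmetric ones, only
      the symmetric part of \<open>w\<close> counts\<close>
    define W where "W = w + transpose w"
    have W_inner: "N \<bullet> W = 2 * (w \<bullet> N)" if "symmetric_mat N" for N
      using that transpose_inner[of w N]
      by (simp add: W_def inner_add_right inner_commute[of N] symmetric_mat_def)
    have "symmetric_mat M"
      using symmetric_mat_nth[OF Q]
      by (intro symmetric_matI) (simp add: M_def A0_def mult.commute)
    then have "M \<bullet> W < 0"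
      using w(1) by (simp add: W_inner)
    have "psd W"
      unfolding psd_iff_inner_outer
    proof (intro conjI allI)
      show "symmetric_mat W"
        by (rule symmetric_matI) (simp add: W_def transpose_def)
      fix x
      have "outer x + 0 \<in> ?K"
        using psd_outer convex_cone_hull_contains_0 by blast
      then show "0 \<le> W \<bullet> outer x"
        using w(2) W_inner[OF psd_symmetric[OF psd_outer]] by (simp add: inner_commute[of W])
    qed
    moreover have "Hmat l u \<beta> p \<bullet> W \<le> 0" if "p \<in> idx l u" for p
    proof -
      have "?g p \<in> ?P"
        using that by (intro hull_inc) blast
      then have "0 + ?g p \<in> ?K"
        using psd_0 by blast
      then have "0 \<le> w \<bullet> ?g p"
        using w(2) by force
      then show ?thesis
        by (simp add: W_inner symmetric_Hmat)
    qed
    ultimately have W: "W \<in> hom_cone l u \<beta>"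
      by (simp add: hom_cone_def)
    define t where "t = A0 \<bullet> W"
    have "W \<noteq> 0"
      using \<open>M \<bullet> W < 0\<close> by auto
    then have "0 < t"
      using hom_cone_pos[where l = l and u = u and \<beta> = \<beta>, OF lu W] by (simp add: t_def)
    then have "primal_feasible l u \<beta> ((1 / t) *\<^sub>R W)"
      using W by (simp add: primal_feasible_iff conic_mul[OF conic_hom_cone] t_def)
    from v[OF this] \<open>0 < t\<close> have "v * t \<le> Q \<bullet> W"
      by (simp add: field_simps)
    with \<open>M \<bullet> W < 0\<close> show False
      by (simp add: M_def inner_diff_left t_def)
  qed
  then obtain S T where S: "psd S" and T: "T \<in> ?P" and M: "M = S + T"
    by blast
  obtain c where c: "\<And>p. p \<in> idx l u \<Longrightarrow> 0 \<le> c p" "T = (\<Sum>p\<in>idx l u. c p *\<^sub>R ?g p)"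
    using convex_cone_hull_image_sum[OF finite_idx T] by blast
  \<comment> \<open>\<open>y\<^sub>0\<close> compensates for the contribution of the other coordinates to the objective\<close>
  define y where "y = (v + (\<Sum>p\<in>idx l u. \<beta> p * c p), restrict (\<lambda>p. - c p) (idx l u))"
  have val: "dinner l u (bvec l u \<beta>) y = v"
    by (simp add: dinner_bvec y_def sum_negf)
  have "Aadj l u \<beta> y = v *\<^sub>R A0 + T"
    unfolding Aadj_eq_Hmat val by (simp add: y_def c(2))
  then have "Q - Aadj l u \<beta> y = S"
    using M by (simp add: M_def algebra_simps)
  then have "dual_feasible Q l u \<beta> y"
    using S c(1) by (simp add: dual_feasible_def dvecs_def y_def)
  with val that show thesis
    by blast
qed

lemma symmetric_Qmat: "symmetric_mat Qhat \<Longrightarrow> symmetric_mat (Qmat Qhat lhat chat)"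
  by (rule symmetric_matI) (auto simp: Qmat_def dest: symmetric_mat_nth split: option.split)

theorem corollary6:
  fixes Qhat :: "real^'n^'n" and lhat :: "real^'n" and chat :: real
    and l u :: "'n::finite \<Rightarrow> int" and \<beta> :: "'n \<times> int \<Rightarrow> real"
  assumes "symmetric_mat Qhat"
    and "\<And>i. l i < u i"
  defines "Q \<equiv> Qmat Qhat lhat chat"
  shows "(\<exists>X. is_arg_min (\<lambda>X. Q \<bullet> X) (primal_feasible l u \<beta>) X)
    \<and> (\<exists>y. is_arg_max (\<lambda>y. dinner l u (bvec l u \<beta>) y) (dual_feasible Q l u \<beta>) y)
    \<and> primal_value Q l u \<beta> = dual_value Q l u \<beta>"
proof -
  obtain X where X: "primal_feasible l u \<beta> X"
      "\<And>Y. primal_feasible l u \<beta> Y \<Longrightarrow> Q \<bullet> X \<le> Q \<bullet> Y"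
    using primal_attained[where l = l and u = u and \<beta> = \<beta>, OF assms(2)] by blast
  obtain y where y: "dual_feasible Q l u \<beta> y" "dinner l u (bvec l u \<beta>) y = Q \<bullet> X"
    using dual_attains_lower_bound[where l = l and u = u and \<beta> = \<beta>, OF assms(2) _ X(2)] symmetric_Qmat[OF assms(1)]
    unfolding Q_def by blast
  have ub: "dinner l u (bvec l u \<beta>) z \<le> Q \<bullet> X" if "dual_feasible Q l u \<beta> z" for z
    using weak_duality[OF X(1) that] .
  have "primal_value Q l u \<beta> = ereal (Q \<bullet> X)"
    unfolding primal_value_def using X by (intro INF_eqI) auto
  moreover have "dual_value Q l u \<beta> = ereal (Q \<bullet> X)"
    unfolding dual_value_def
  proof (rule SUP_eqI)
    fix b assume "\<And>z. z \<in> {y. dual_feasible Q l u \<beta> y} \<Longrightarrow> ereal (dinner l u (bvec l u \<beta>) z) \<le> b"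
    from this[of y] y show "ereal (Q \<bullet> X) \<le> b"
      by simp
  qed (simp add: ub)
  moreover have "is_arg_min (\<lambda>X. Q \<bullet> X) (primal_feasible l u \<beta>) X"
    using X by (auto simp: is_arg_min_def not_less)
  moreover have "is_arg_max (\<lambda>y. dinner l u (bvec l u \<beta>) y) (dual_feasible Q l u \<beta>) y"
    using y ub by (auto simp: is_arg_max_def not_less)
  ultimately show ?thesis
    by (intro conjI exI[of _ X] exI[of _ y]) simp_all
qed

end
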